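(* Let $\mathcal{N}$ be a $(\mathrm{Col},\delta)$-sum-GNN with $L\ge 1$ layers, and let $r$ be a Datalog rule of the form $B_1\wedge\dots\wedge B_n\to H$ where $H$ mentions a unary predicate $U_p$, $p\in\{1,\dots,\delta\}$. Let $S$ be an arbitrary set of as many constants as there are variables in $r$. Assume that channel $p$ in $\mathcal{N}$ is increasing or stable at layer $L$. Then $r$ is sound for $T_{\mathcal{N}}$ (that is, $T_r(D)\subseteq T_{\mathcal{N}}(D)$ for each dataset $D$) if and only if $H\nu\in T_{\mathcal{N}}(D_r^{\nu})$ for each substitution $\nu$ mapping the variables of $r$ to constants in $S$ and such that $D_r^{\nu}\models B_i\nu$ for each inequality $B_i$ in $r$.
   Context: **Signature and Datalog.** Fix a finite set $\mathrm{Col}$ of colours and $\delta\in\mathbb{N}$, $\delta\geq 1$. The signature consists of unary predicates $U_1,\dots,U_\delta$ and one binary predicate $R^c$ for each $c\in\mathrm{Col}$, together with a countably infinite set of constants; there is also a countably infinite set of variables. All rules and datasets are over this signature. A term is a variable or a constant. An atom is a predicate applied to terms; a literal is an atom or an inequality $t_1\not\approx t_2$ between terms. A fact is an atom without variables; a dataset is a finite set of facts. A rule is $B_1\wedge\dots\wedge B_n\to H$ with body literals $B_i$ and head atom $H$, where every variable of the rule occurs in a body atom and each body inequality mentions two different terms. A substitution $\nu$ maps finitely many variables to constants, and $\alpha\nu$ denotes the result of applying $\nu$ to the literal $\alpha$. For a dataset $D$, write $D\models B$ for a fact $B$ if $B\in D$, and $D\models a_1\not\approx a_2$ for constants $a_1,a_2$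 if $a_1\neq a_2$. $T_r(D)$ is the set of all $H\nu$ for substitutions $\nu$ with $D\models B_i\nu$ for all $i$. For a rule $r$ and substitution $\nu$, $D_r^\nu$ is the dataset of all facts $B_i\nu$ such that $B_i$ is a body atom (not an inequality) of $r$. **Sum-GNNs.** A $(\mathrm{Col},\delta)$-graph is $\langle V,\{E^c\}_{c\in\mathrm{Col}},\lambda\rangle$ with $V$ a finite vertex set, $E^c\subseteq V\times V$, and $\lambda(v)\in\mathbb{R}^\delta$ for each $v \in V$. A $(\mathrm{Col},\delta)$-sum-GNN $\mathcal{N}$ with $L\ge1$ layers consists of dimensions $\delta_0,\dots,\delta_L$ with $\delta_0=\delta_L=\delta$ and, for each $\ell\in\{1,\dots,L\}$ and $c\in\mathrm{Col}$, real matrices $\mathbf{A}_\ell,\mathbf{B}^c_\ell$ of size $\delta_\ell\times\delta_{\ell-1}$, a vector $\mathbf{b}_\ell\in\mathbb{R}^{\delta_\ell}$, an activation function $\sigma_\ell:\mathbb{R}\to[0,\infty)$ that is monotonically increasing ($x<y$ implies $\sigma_\ell(x)\le\sigma_\ell(y)$), and a threshold $t\in\mathbb{R}$ with classification function $\mathtt{cls}_t(x)=1$ if $x\ge t$ and $0$ otherwise. Applied to a $(\mathrm{Col},\delta)$-graph it computes, for each vertex $v$, $\mathbf{v}_0=\lambda(v)$ and $$\mathbf{v}_\ell=\sigma_\ell\Big(\mathbf{b}_\ell+\mathbf{A}_\ell\mathbf{v}_{\ell-1}+\sum_{c\in\mathrm{Col}}\mathbf{B}^c_\ell\sum_{(v,u)\in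 E^c}\mathbf{u}_{\ell-1}\Big),\quad 1\le\ell\le L,$$ (functions applied element-wise). The output is the graph with the same vertices and edges, where $v$ is labelled by $\mathtt{cls}_t(\mathbf{v}_L)$. Each $i\in\{1,\dots,\delta_\ell\}$ is called a channel of layer $\ell$. **Dataset transformation.** The canonical encoding $\mathtt{enc}(D)$ of a dataset $D$ is the graph with a vertex $v_a$ for each constant $a$ in $D$, an edge $(v_a,v_b)\in E^c$ for each $R^c(a,b)\in D$, and initial labels with $p$-th component of $v_a$ equal to $1$ if $U_p(a)\in D$ and $0$ otherwise. The decoder $\mathtt{dec}$ is the inverse: it maps a Boolean-labelled graph to the set of all $R^c(a,b)$ with $(v_a,v_b)\in E^c$ and all $U_p(a)$ with $p$-th label component of $v_a$ equal to $1$. $T_{\mathcal{N}}(D)=\mathtt{dec}(\mathcal{N}(\mathtt{enc}(D)))$. **Stable, increasing, decreasing, undetermined channels.** All channels are increasing at layer $0$. For $\ell\in\{1,\dots,L\}$, channel $i\in\{1,\dots,\delta_\ell\}$ is stable at layer $\ell$ if for each $j\in\{1,\dots,\delta_{\ell-1}\}$: $\mathbf{B}^c_\ell[i,j]=0$ for each $c\in\mathrm{Col}$, and $\mathbf{A}_\ell[i,j]\neq0$ implies that $j$ is stable at layer $\ell-1$. It is increasing (resp. decreasing) at layer $\ell$ if it is not stable and, for each $j\in\{1,\dots,\delta_{\ell-1}\}$: (1) if $j$ is increasing at $\ell-1$, then $\mathbf{A}_\ell[i,j]\ge0$ (resp. $\le0$); (2) if $j$ is decreasing at $\ell-1$, then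 $\mathbf{A}_\ell[i,j]\le0$ (resp. $\ge0$) and $\mathbf{B}^c_\ell[i,j]=0$ for each $c\in\mathrm{Col}$; (3) if $j$ is undetermined at $\ell-1$, then $\mathbf{A}_\ell[i,j]=0$ and $\mathbf{B}^c_\ell[i,j]=0$ for each $c\in\mathrm{Col}$; (4) $\mathbf{B}^c_\ell[i,j]\ge0$ (resp. $\le0$) for each $c\in\mathrm{Col}$. It is undetermined at layer $\ell$ if it is neither stable, increasing, nor decreasing.
   Formalization: The equivalence fails for rules mentioning constants; it is proved as printed for constant-free rules, and for rules with constants with S disjoint from them and substitutions into S together with the rule's constants. Soundness implies the test on S for all rules. *)

theory Defs
  imports
    Complex_Main
    "HOL-Library.Countable"
    "HOL-Library.Infinite_Typeclass"
    "Jordan_Normal_Form.Matrix"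
begin

section \<open>Datalog\<close>

text \<open>
  Unary predicates, channels and vector components are all counted from 0, so that
  the signature has the unary predicates \<open>U p\<close> for \<open>p < \<delta>\<close> and the binary
  predicates \<open>R c\<close> for \<open>c \<in> Col\<close>. Atoms and literals are parametric in their terms:
  facts are atoms whose terms are constants, rule atoms have terms of type \<open>trm\<close>.
\<close>

datatype (trm_vars: 'v, trm_consts: 'k) trm = Var 'v | Const 'k

datatype (atom_colours: 'c, atom_terms: 't) atom = U nat 't | R 'c 't 't

datatype (lit_colours: 'c, lit_terms: 't) literal =
  Atom "('c, 't) atom"
| Neq 't 't

type_synonym ('c, 'k) fact = "('c, 'k) atom"

datatype ('c, 'v, 'k) rule =
  Rule (body: "('c, ('v, 'k) trm) literal list") (head: "('c, ('v, 'k) trm) atom")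

fun atom_over :: "'c set \<Rightarrow> nat \<Rightarrow> ('c, 't) atom \<Rightarrow> bool" where
  "atom_over Col \<delta> (U p t) \<longleftrightarrow> p < \<delta>"
| "atom_over Col \<delta> (R c s t) \<longleftrightarrow> c \<in> Col"

definition dataset :: "'c set \<Rightarrow> nat \<Rightarrow> ('c, 'k) fact set \<Rightarrow> bool" where
  "dataset Col \<delta> D \<longleftrightarrow> finite D \<and> (\<forall>B\<in>D. atom_over Col \<delta> B)"

definition dataset_consts :: "('c, 'k) fact set \<Rightarrow> 'k set" where
  "dataset_consts D = (\<Union>B\<in>D. atom_terms B)"

definition rule_terms :: "('c, 'v, 'k) rule \<Rightarrow> ('v, 'k) trm set" where
  "rule_terms r = (\<Union>l\<in>set (body r). lit_terms l) \<union> atom_terms (head r)"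

definition rule_vars :: "('c, 'v, 'k) rule \<Rightarrow> 'v set" where
  "rule_vars r = (\<Union>t\<in>rule_terms r. trm_vars t)"

definition rule_consts :: "('c, 'v, 'k) rule \<Rightarrow> 'k set" where
  "rule_consts r = (\<Union>t\<in>rule_terms r. trm_consts t)"

definition body_atoms :: "('c, 'v, 'k) rule \<Rightarrow> ('c, ('v, 'k) trm) atom set" where
  "body_atoms r = {A. Atom A \<in> set (body r)}"

definition rule_over :: "'c set \<Rightarrow> nat \<Rightarrow> ('c, 'v, 'k) rule \<Rightarrow> bool" where
  "rule_over Col \<delta> r \<longleftrightarrow>
     (\<forall>A\<in>body_atoms r. atom_over Col \<delta> A) \<and> atom_over Col \<delta> (head r) \<and>
     (\<forall>x\<in>rule_vars r. \<exists>A\<in>body_atoms r. \<exists>t\<in>atom_terms A. x \<in> trm_vars t) \<and>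
     (\<forall>s t. Neq s t \<in> set (body r) \<longrightarrow> s \<noteq> t)"

type_synonym ('v, 'k) subst = "'v \<Rightarrow> 'k option"

text \<open>
  Applying a substitution yields terms that are constants, so it is only meaningful on
  expressions whose variables all lie in \<open>dom \<nu>\<close>; every use below guarantees this.
\<close>

fun subst_trm :: "('v, 'k) subst \<Rightarrow> ('v, 'k) trm \<Rightarrow> 'k" where
  "subst_trm \<nu> (Var x) = the (\<nu> x)"
| "subst_trm \<nu> (Const a) = a"

definition subst_atom :: "('v, 'k) subst \<Rightarrow> ('c, ('v, 'k) trm) atom \<Rightarrow> ('c, 'k) fact" where
  "subst_atom \<nu> = map_atom id (subst_trm \<nu>)"

definition subst_lit :: "('v, 'k) subst \<Rightarrow> ('c, ('v, 'k) trm) literal \<Rightarrow> ('c, 'k) literal" where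
  "subst_lit \<nu> = map_literal id (subst_trm \<nu>)"

fun models :: "('c, 'k) fact set \<Rightarrow> ('c, 'k) literal \<Rightarrow> bool" where
  "models D (Atom B) \<longleftrightarrow> B \<in> D"
| "models D (Neq a b) \<longleftrightarrow> a \<noteq> b"

definition rule_op :: "('c, 'v, 'k) rule \<Rightarrow> ('c, 'k) fact set \<Rightarrow> ('c, 'k) fact set" where
  "rule_op r D = {subst_atom \<nu> (head r) | \<nu>.
     finite (dom \<nu>) \<and> rule_vars r \<subseteq> dom \<nu> \<and> (\<forall>l\<in>set (body r). models D (subst_lit \<nu> l))}"

definition body_dataset :: "('c, 'v, 'k) rule \<Rightarrow> ('v, 'k) subst \<Rightarrow> ('c, 'k) fact set" where
  "body_dataset r \<nu> = subst_atom \<nu> ` body_atoms r"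


section \<open>Sum-GNNs\<close>

record ('c, 'a) graph =
  verts :: "'a set"
  edges :: "'c \<Rightarrow> ('a \<times> 'a) set"
  label :: "'a \<Rightarrow> real vec"

record 'c gnn =
  layers :: nat
  gdim :: "nat \<Rightarrow> nat"
  matA :: "nat \<Rightarrow> real mat"
  matB :: "nat \<Rightarrow> 'c \<Rightarrow> real mat"
  bias :: "nat \<Rightarrow> real vec"
  act :: "nat \<Rightarrow> real \<Rightarrow> real"
  threshold :: real

definition sum_gnn :: "'c set \<Rightarrow> nat \<Rightarrow> 'c gnn \<Rightarrow> bool" where
  "sum_gnn Col \<delta> N \<longleftrightarrow>
     layers N \<ge> 1 \<and> gdim N 0 = \<delta> \<and> gdim N (layers N) = \<delta> \<and>
     (\<forall>l\<in>{1..layers N}.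
        matA N l \<in> carrier_mat (gdim N l) (gdim N (l - 1)) \<and>
        (\<forall>c\<in>Col. matB N l c \<in> carrier_mat (gdim N l) (gdim N (l - 1))) \<and>
        bias N l \<in> carrier_vec (gdim N l) \<and>
        mono (act N l) \<and> (\<forall>x. act N l x \<ge> 0))"

definition cls :: "real \<Rightarrow> real \<Rightarrow> real" where
  "cls t x = (if x \<ge> t then 1 else 0)"

primrec feat :: "'c set \<Rightarrow> 'c gnn \<Rightarrow> ('c, 'a) graph \<Rightarrow> nat \<Rightarrow> 'a \<Rightarrow> real vec" where
  "feat Col N G 0 v = label G v"
| "feat Col N G (Suc l) v =
     map_vec (act N (Suc l))
       (bias N (Suc l) + matA N (Suc l) *\<^sub>v feat Col N G l v +
        finsum_vec TYPE(real) (gdim N (Suc l))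
          (\<lambda>c. matB N (Suc l) c *\<^sub>v
                finsum_vec TYPE(real) (gdim N l) (\<lambda>u. feat Col N G l u) {u. (v, u) \<in> edges G c})
          Col)"

definition gnn_apply :: "'c set \<Rightarrow> 'c gnn \<Rightarrow> ('c, 'a) graph \<Rightarrow> ('c, 'a) graph" where
  "gnn_apply Col N G =
     G\<lparr>label := (\<lambda>v. map_vec (cls (threshold N)) (feat Col N G (layers N) v))\<rparr>"

text \<open>The vertex of the canonical encoding that represents a constant is the constant itself.\<close>

definition enc :: "nat \<Rightarrow> ('c, 'k) fact set \<Rightarrow> ('c, 'k) graph" where
  "enc \<delta> D = \<lparr>verts = dataset_consts D,
              edges = (\<lambda>c. {(a, b). R c a b \<in> D}),
              label = (\<lambda>a. vec \<delta> (\<lambda>p. if U p a \<in> D then 1 else 0))\<rparr>"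

definition dec :: "'c set \<Rightarrow> nat \<Rightarrow> ('c, 'k) graph \<Rightarrow> ('c, 'k) fact set" where
  "dec Col \<delta> G = {R c a b | c a b. c \<in> Col \<and> (a, b) \<in> edges G c} \<union>
                 {U p a | p a. p < \<delta> \<and> a \<in> verts G \<and> label G a $ p = 1}"

definition gnn_op :: "'c set \<Rightarrow> nat \<Rightarrow> 'c gnn \<Rightarrow> ('c, 'k) fact set \<Rightarrow> ('c, 'k) fact set" where
  "gnn_op Col \<delta> N D = dec Col \<delta> (gnn_apply Col N (enc \<delta> D))"

definition sound :: "'c set \<Rightarrow> nat \<Rightarrow> 'c gnn \<Rightarrow> ('c, 'v, 'k) rule \<Rightarrow> bool" where
  "sound Col \<delta> N r \<longleftrightarrow> (\<forall>D. dataset Col \<delta> D \<longrightarrow> rule_op r D \<subseteq> gnn_op Col \<delta> N D)"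


section \<open>Stable, increasing, decreasing and undetermined channels\<close>

fun stable_channel :: "'c set \<Rightarrow> 'c gnn \<Rightarrow> nat \<Rightarrow> nat \<Rightarrow> bool" where
  "stable_channel Col N 0 i \<longleftrightarrow> False"
| "stable_channel Col N (Suc l) i \<longleftrightarrow>
     (\<forall>j<gdim N l. (\<forall>c\<in>Col. matB N (Suc l) c $$ (i, j) = 0) \<and>
                   (matA N (Suc l) $$ (i, j) \<noteq> 0 \<longrightarrow> stable_channel Col N l j))"

fun increasing_channel :: "'c set \<Rightarrow> 'c gnn \<Rightarrow> nat \<Rightarrow> nat \<Rightarrow> bool"
  and decreasing_channel :: "'c set \<Rightarrow> 'c gnn \<Rightarrow> nat \<Rightarrow> nat \<Rightarrow> bool"
  and undetermined_channel :: "'c set \<Rightarrow> 'c gnn \<Rightarrow> nat \<Rightarrow> nat \<Rightarrow> bool" where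
  "increasing_channel Col N 0 i \<longleftrightarrow> True"
| "increasing_channel Col N (Suc l) i \<longleftrightarrow>
     \<not> stable_channel Col N (Suc l) i \<and>
     (\<forall>j<gdim N l.
        (increasing_channel Col N l j \<longrightarrow> matA N (Suc l) $$ (i, j) \<ge> 0) \<and>
        (decreasing_channel Col N l j \<longrightarrow>
           matA N (Suc l) $$ (i, j) \<le> 0 \<and> (\<forall>c\<in>Col. matB N (Suc l) c $$ (i, j) = 0)) \<and>
        (undetermined_channel Col N l j \<longrightarrow>
           matA N (Suc l) $$ (i, j) = 0 \<and> (\<forall>c\<in>Col. matB N (Suc l) c $$ (i, j) = 0)) \<and>
        (\<forall>c\<in>Col. matB N (Suc l) c $$ (i, j) \<ge> 0))"
| "decreasing_channel Col N 0 i \<longleftrightarrow> False"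
| "decreasing_channel Col N (Suc l) i \<longleftrightarrow>
     \<not> stable_channel Col N (Suc l) i \<and>
     (\<forall>j<gdim N l.
        (increasing_channel Col N l j \<longrightarrow> matA N (Suc l) $$ (i, j) \<le> 0) \<and>
        (decreasing_channel Col N l j \<longrightarrow>
           matA N (Suc l) $$ (i, j) \<ge> 0 \<and> (\<forall>c\<in>Col. matB N (Suc l) c $$ (i, j) = 0)) \<and>
        (undetermined_channel Col N l j \<longrightarrow>
           matA N (Suc l) $$ (i, j) = 0 \<and> (\<forall>c\<in>Col. matB N (Suc l) c $$ (i, j) = 0)) \<and>
        (\<forall>c\<in>Col. matB N (Suc l) c $$ (i, j) \<le> 0))"
| "undetermined_channel Col N 0 i \<longleftrightarrow> False"
| "undetermined_channel Col N (Suc l) i \<longleftrightarrow>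
     \<not> stable_channel Col N (Suc l) i \<and> \<not> increasing_channel Col N (Suc l) i \<and> \<not> decreasing_channel Col N (Suc l) i"


section \<open>The finite soundness test\<close>

text \<open>
  A finite set \<open>S\<close> with as many elements as the rule has variables is enough only for rules
  without constants. For \<open>R(x,y) \<and> U(y) \<and> R(x,a) \<and> U(a) \<longrightarrow> U(x)\<close> and a network that
  checks whether the successors of a vertex contain at least two elements of \<open>U\<close>, every
  substitution into \<open>S = {b, c}\<close> passes, whereas the omitted substitution \<open>y \<mapsto> a\<close> fails.
  Rules with constants need the test on \<open>S \<union> rule_consts r\<close>, where \<open>S\<close> is disjoint
  from \<open>rule_consts r\<close>; this is the test on \<open>S\<close> if \<open>rule_consts r = {}\<close>.
\<close>

definition passes_test ::
    "'c set \<Rightarrow> nat \<Rightarrow> 'c gnn \<Rightarrow> ('c, 'v, 'k) rule \<Rightarrow> 'k set \<Rightarrow> bool" where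
  "passes_test Col \<delta> N r S \<longleftrightarrow>
     (\<forall>\<nu>. dom \<nu> = rule_vars r \<and> ran \<nu> \<subseteq> S \<and>
          (\<forall>s t. Neq s t \<in> set (body r) \<longrightarrow> models (body_dataset r \<nu>) (subst_lit \<nu> (Neq s t)))
        \<longrightarrow> subst_atom \<nu> (head r) \<in> gnn_op Col \<delta> N (body_dataset r \<nu>))"

end

theory Submission
  imports Defs
begin

text \<open>
  An injective homomorphism of datasets \<open>f : D\<^sub>1 \<rightarrow> D\<^sub>2\<close> can only increase the values of
  increasing channels, only decrease those of decreasing channels, and leaves stable channels
  unchanged; injectivity lets the successors of \<open>a\<close> in \<open>D\<^sub>1\<close> embed into those of \<open>f a\<close> in
  \<open>D\<^sub>2\<close>, and the extra successors contribute nonnegative summands. Given a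
  match \<open>\<nu>\<close> of the rule in \<open>D\<close>, an injective renaming of constants that fixes those of the rule
  turns \<open>\<nu>\<close> into a tested substitution \<open>\<nu>'\<close>, and the inverse renaming is such a
  homomorphism from the body dataset of \<open>\<nu>'\<close> to \<open>D\<close>.
\<close>

section \<open>Features of a sum-GNN, componentwise\<close>

text \<open>Cases on the layer suffice without induction: a vector sum takes the dimension of its
  right summand, here the aggregated term, and that one has \<open>gdim N (Suc k)\<close> entries
  whatever the features of layer \<open>k\<close> are.\<close>

lemma feat_carrier:
  assumes "sum_gnn Col \<delta> N" and "\<And>v. label G v \<in> carrier_vec \<delta>" and "l \<le> layers N"
  shows "feat Col N G l v \<in> carrier_vec (gdim N l)"
proof (cases l)
  case 0
  then show ?thesis using assms by (simp add: sum_gnn_def)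
next
  case (Suc k)
  then have "Suc k \<in> {1..layers N}" using assms by auto
  then have B: "\<And>c. c \<in> Col \<Longrightarrow> matB N (Suc k) c \<in> carrier_mat (gdim N (Suc k)) (gdim N k)"
    using assms(1) unfolding sum_gnn_def by force
  have F: "finsum_vec TYPE(real) (gdim N (Suc k))
          (\<lambda>c. matB N (Suc k) c *\<^sub>v
                finsum_vec TYPE(real) (gdim N k) (\<lambda>u. feat Col N G k u) {u. (v, u) \<in> edges G c})
          Col \<in> carrier_vec (gdim N (Suc k))"
    using carrier_matD(1)[OF B] by (intro finsum_vec_closed) (auto intro!: carrier_vecI)
  show ?thesis using Suc carrier_vecD[OF F] by (auto intro!: carrier_vecI)
qed

text \<open>Reduces a layer to real sums, so that sign conditions on single matrix entries can be
  applied summand by summand. Finiteness of \<open>Col\<close> and of the neighbourhoods lets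
  \<open>finsum_vec\<close> be read componentwise.\<close>

lemma feat_Suc_index:
  fixes G :: "('c, 'a) graph"
  assumes N: "sum_gnn Col \<delta> N" and lab: "\<And>v. label G v \<in> carrier_vec \<delta>"
    and Col: "finite Col" and nbrs: "\<And>c. c \<in> Col \<Longrightarrow> finite {u. (v, u) \<in> edges G c}"
    and l: "Suc l \<le> layers N" and i: "i < gdim N (Suc l)"
  shows "feat Col N G (Suc l) v $ i =
    act N (Suc l) (bias N (Suc l) $ i + (\<Sum>j<gdim N l. matA N (Suc l) $$ (i, j) * feat Col N G l v $ j) +
      (\<Sum>c\<in>Col. \<Sum>j<gdim N l. matB N (Suc l) c $$ (i, j) * (\<Sum>u | (v, u) \<in> edges G c. feat Col N G l u $ j)))"
proof -
  have "Suc l \<in> {1..layers N}" using l by auto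
  then have A: "matA N (Suc l) \<in> carrier_mat (gdim N (Suc l)) (gdim N l)"
    and B: "\<And>c. c \<in> Col \<Longrightarrow> matB N (Suc l) c \<in> carrier_mat (gdim N (Suc l)) (gdim N l)"
    using N unfolding sum_gnn_def by force+
  have x: "feat Col N G l u \<in> carrier_vec (gdim N l)" for u
    using feat_carrier[OF N lab] l by simp
  define s where "s c = finsum_vec TYPE(real) (gdim N l) (\<lambda>u. feat Col N G l u) {u. (v, u) \<in> edges G c}" for c
  have s: "s c \<in> carrier_vec (gdim N l)" for c
    unfolding s_def using x by (intro finsum_vec_closed) auto
  have s_index: "s c $ j = (\<Sum>u | (v, u) \<in> edges G c. feat Col N G l u $ j)"
    if "c \<in> Col" "j < gdim N l" for c j
    unfolding s_def using that nbrs x by (subst index_finsum_vec) auto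
  have mult: "(M *\<^sub>v y) $ i = (\<Sum>j<gdim N l. M $$ (i, j) * y $ j)"
    if "M \<in> carrier_mat (gdim N (Suc l)) (gdim N l)" "y \<in> carrier_vec (gdim N l)" for M and y :: "real vec"
    using that i by (auto simp: scalar_prod_def lessThan_atLeast0)
  have BC: "(\<lambda>c. matB N (Suc l) c *\<^sub>v s c) \<in> Col \<rightarrow> carrier_vec (gdim N (Suc l))"
    using carrier_matD(1)[OF B] by (auto intro!: carrier_vecI)
  have F: "finsum_vec TYPE(real) (gdim N (Suc l)) (\<lambda>c. matB N (Suc l) c *\<^sub>v s c) Col
      \<in> carrier_vec (gdim N (Suc l))"
    using BC by (rule finsum_vec_closed)
  have "feat Col N G (Suc l) v $ i = act N (Suc l) (bias N (Suc l) $ i +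
      (matA N (Suc l) *\<^sub>v feat Col N G l v) $ i + (\<Sum>c\<in>Col. (matB N (Suc l) c *\<^sub>v s c) $ i))"
    using i A F index_finsum_vec[OF Col i BC] by (simp flip: s_def)
  also have "(\<Sum>c\<in>Col. (matB N (Suc l) c *\<^sub>v s c) $ i) = (\<Sum>c\<in>Col. \<Sum>j<gdim N l.
      matB N (Suc l) c $$ (i, j) * (\<Sum>u | (v, u) \<in> edges G c. feat Col N G l u $ j))"
    using mult[OF B s] s_index by simp
  finally show ?thesis using mult[OF A x] by simp
qed

text \<open>From layer 1 on the reason is that activations take nonnegative values; layer 0 rests on
  the labels.\<close>

lemma feat_nonneg:
  assumes N: "sum_gnn Col \<delta> N" and lab: "\<And>v. label G v \<in> carrier_vec \<delta>"
    and nonneg: "\<And>v i. i < \<delta> \<Longrightarrow> label G v $ i \<ge> 0"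
    and l: "l \<le> layers N" and i: "i < gdim N l"
  shows "feat Col N G l v $ i \<ge> 0"
proof (cases l)
  case 0
  then show ?thesis using N nonneg i by (simp add: sum_gnn_def)
next
  case (Suc k)
  then have "act N l x \<ge> 0" for x
    using N l by (simp add: sum_gnn_def)
  then show ?thesis
    using carrier_vecD[OF feat_carrier[OF N lab l, of v]] i Suc by simp
qed


section \<open>Monotonicity under injective homomorphisms\<close>

text \<open>At layer 0 every channel is increasing; above it, undetermined is by definition the
  complement of the other kinds. This drives the case split over the channels of the previous
  layer.\<close>

lemma channel_cases:
  "stable_channel Col N l j \<or> increasing_channel Col N l j \<or>
   decreasing_channel Col N l j \<or> undetermined_channel Col N l j"
  by (cases l) auto

text \<open>Induction on the layer. The three claims go together because the conditions on one kind
  refer to other kinds one layer below. Undetermined channels get no claim: they enter channels of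
  the other three kinds only with coefficient 0.\<close>

lemma feat_mono:
  fixes G :: "('c, 'a) graph" and G' :: "('c, 'b) graph"
  assumes Col: "finite Col" and N: "sum_gnn Col \<delta> N"
    and lab: "\<And>v. label G v \<in> carrier_vec \<delta>" "\<And>v. label G' v \<in> carrier_vec \<delta>"
    and nonneg: "\<And>v i. i < \<delta> \<Longrightarrow> label G' v $ i \<ge> 0"
    and le: "\<And>v i. v \<in> V \<Longrightarrow> i < \<delta> \<Longrightarrow> label G v $ i \<le> label G' (f v) $ i"
    and fin: "\<And>c v. finite {u. (v, u) \<in> edges G c}" "\<And>c v. finite {u. (v, u) \<in> edges G' c}"
    and f: "inj_on f V"
    and hom: "\<And>c v u. (v, u) \<in> edges G c \<Longrightarrow> u \<in> V \<and> (f v, f u) \<in> edges G' c"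
    and "l \<le> layers N" "i < gdim N l" "v \<in> V"
  shows "(stable_channel Col N l i \<longrightarrow> feat Col N G l v $ i = feat Col N G' l (f v) $ i) \<and>
    (increasing_channel Col N l i \<longrightarrow> feat Col N G l v $ i \<le> feat Col N G' l (f v) $ i) \<and>
    (decreasing_channel Col N l i \<longrightarrow> feat Col N G l v $ i \<ge> feat Col N G' l (f v) $ i)"
  using \<open>l \<le> layers N\<close> \<open>i < gdim N l\<close> \<open>v \<in> V\<close>
proof (induction l arbitrary: i v)
  case 0
  then show ?case using le N by (simp add: sum_gnn_def)
next
  case (Suc l)
  define x where "x u = feat Col N G l u" for u
  define y where "y u = feat Col N G' l u" for u
  define A where "A = matA N (Suc l)"
  define B where "B = matB N (Suc l)"
  define X where "X c j = (\<Sum>u | (v, u) \<in> edges G c. x u $ j)" for c j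
  define Y where "Y c j = (\<Sum>u | (f v, u) \<in> edges G' c. y u $ j)" for c j
  note IH = Suc.IH[folded x_def y_def, OF Suc_leD[OF Suc.prems(1)]]
  have mono: "mono (act N (Suc l))"
    using N Suc.prems(1) unfolding sum_gnn_def by force
  \<comment> \<open>For a decreasing \<open>j\<close> the values shrink while further successors add
    to the sum, so the two neighbour sums are in general incomparable; there the definitions force
    the entries of \<open>B\<close> to vanish.\<close>
  have X_le_Y: "X c j \<le> Y c j"
    if j: "j < gdim N l" and "stable_channel Col N l j \<or> increasing_channel Col N l j" for c j
  proof -
    let ?E = "{u. (v, u) \<in> edges G c}"
    have E: "?E \<subseteq> V" using hom by auto
    have "X c j \<le> (\<Sum>u\<in>?E. y (f u) $ j)"
      unfolding X_def
    proof (rule sum_mono)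
      fix u assume "u \<in> ?E"
      then have "u \<in> V" using E by auto
      from IH[OF j this] that show "x u $ j \<le> y (f u) $ j" by auto
    qed
    also have "\<dots> = (\<Sum>w\<in>f ` ?E. y w $ j)"
      using inj_on_subset[OF f E] by (simp add: sum.reindex)
    also have "\<dots> \<le> Y c j"
      unfolding Y_def using hom feat_nonneg[OF N lab(2) nonneg _ j] Suc.prems(1)
      by (intro sum_mono2 fin) (auto simp: y_def)
    finally show ?thesis .
  qed
  have G: "feat Col N G (Suc l) v $ i = act N (Suc l) (bias N (Suc l) $ i +
      (\<Sum>j<gdim N l. A $$ (i, j) * x v $ j) + (\<Sum>c\<in>Col. \<Sum>j<gdim N l. B c $$ (i, j) * X c j))"
    using feat_Suc_index[OF N lab(1) Col fin(1) Suc.prems(1,2)]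
    by (simp only: A_def B_def x_def X_def)
  have G': "feat Col N G' (Suc l) (f v) $ i = act N (Suc l) (bias N (Suc l) $ i +
      (\<Sum>j<gdim N l. A $$ (i, j) * y (f v) $ j) + (\<Sum>c\<in>Col. \<Sum>j<gdim N l. B c $$ (i, j) * Y c j))"
    using feat_Suc_index[OF N lab(2) Col fin(2) Suc.prems(1,2)]
    by (simp only: A_def B_def y_def Y_def)
  show ?case
  proof (intro conjI impI)
    assume st: "stable_channel Col N (Suc l) i"
    \<comment> \<open>Either the entry of \<open>A\<close> is 0, or \<open>j\<close> is itself
      stable and both values agree by induction.\<close>
    have "A $$ (i, j) * x v $ j = A $$ (i, j) * y (f v) $ j" if j: "j < gdim N l" for j
      using st j IH[OF j Suc.prems(3)] by (auto simp: A_def)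
    moreover have "B c $$ (i, j) = 0" if "c \<in> Col" "j < gdim N l" for c j
      using st that by (simp add: B_def)
    ultimately show "feat Col N G (Suc l) v $ i = feat Col N G' (Suc l) (f v) $ i"
      unfolding G G'
      by (intro arg_cong[where f = "act N (Suc l)"] arg_cong2[where f = "(+)"] sum.cong refl) auto
  next
    assume inc: "increasing_channel Col N (Suc l) i"
    \<comment> \<open>The sign of the entry matches the direction in which channel \<open>j\<close>
      moves; a stable \<open>j\<close> may have an entry of any sign, since its value does not
      change.\<close>
    have "A $$ (i, j) * x v $ j \<le> A $$ (i, j) * y (f v) $ j" if j: "j < gdim N l" for j
      using inc j IH[OF j Suc.prems(3)] channel_cases[of Col N l j]
      by (auto simp: A_def mult_left_mono mult_left_mono_neg)
    moreover have "B c $$ (i, j) * X c j \<le> B c $$ (i, j) * Y c j"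
      if c: "c \<in> Col" and j: "j < gdim N l" for c j
      using inc c j X_le_Y[OF j, of c] channel_cases[of Col N l j]
      by (auto simp: B_def mult_left_mono)
    ultimately show "feat Col N G (Suc l) v $ i \<le> feat Col N G' (Suc l) (f v) $ i"
      unfolding G G' by (intro monoD[OF mono] add_mono sum_mono order_refl) auto
  next
    assume dec: "decreasing_channel Col N (Suc l) i"
    have "A $$ (i, j) * x v $ j \<ge> A $$ (i, j) * y (f v) $ j" if j: "j < gdim N l" for j
      using dec j IH[OF j Suc.prems(3)] channel_cases[of Col N l j]
      by (auto simp: A_def mult_left_mono mult_left_mono_neg)
    \<comment> \<open>The same estimate \<open>X_le_Y\<close> serves again, now reversed by the
      nonpositive entries of \<open>B\<close>.\<close>
    moreover have "B c $$ (i, j) * X c j \<ge> B c $$ (i, j) * Y c j"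
      if c: "c \<in> Col" and j: "j < gdim N l" for c j
      using dec c j X_le_Y[OF j, of c] channel_cases[of Col N l j]
      by (auto simp: B_def mult_left_mono_neg)
    ultimately show "feat Col N G (Suc l) v $ i \<ge> feat Col N G' (Suc l) (f v) $ i"
      unfolding G G' by (intro monoD[OF mono] add_mono sum_mono order_refl) auto
  qed
qed

section \<open>Transfer from graphs to datasets through the canonical encoding\<close>

lemma dataset_consts_map_atom: "dataset_consts (map_atom id f ` D) = f ` dataset_consts D"
  by (auto simp: dataset_consts_def atom.set_map)

lemma finite_enc_nbrs:
  assumes "finite D"
  shows "finite {u. (v, u) \<in> edges (enc \<delta> D) c}"
proof -
  have "{u. (v, u) \<in> edges (enc \<delta> D) c} = R c v -` D"
    by (auto simp: enc_def)
  then show ?thesis using assms by (simp add: finite_vimageI inj_def)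
qed

text \<open>Classification is by a lower threshold, so a value that stays equal or grows along
  \<open>f\<close> keeps the label 1.\<close>

lemma gnn_op_hom:
  fixes D :: "('c, 'k) fact set" and D' :: "('c, 'l) fact set"
  assumes Col: "finite Col" and N: "sum_gnn Col \<delta> N" and D: "finite D" and D': "finite D'"
    and f: "inj_on f (dataset_consts D)" and hom: "map_atom id f ` D \<subseteq> D'"
    and p: "increasing_channel Col N (layers N) p \<or> stable_channel Col N (layers N) p"
    and U: "U p a \<in> gnn_op Col \<delta> N D"
  shows "U p (f a) \<in> gnn_op Col \<delta> N D'"
proof -
  let ?L = "layers N"
  have lab: "label (enc \<delta> E) v \<in> carrier_vec \<delta>" for E :: "('c, 'x) fact set" and v
    by (simp add: enc_def)
  have dim: "gdim N ?L = \<delta>" using N by (simp add: sum_gnn_def)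
  note carrier = feat_carrier[OF N lab order_refl, unfolded dim]
  have index: "label (gnn_apply Col N (enc \<delta> E)) v $ p = cls (threshold N) (feat Col N (enc \<delta> E) ?L v $ p)"
    if "p < \<delta>" for E :: "('c, 'x) fact set" and v
    using carrier[of E v] that by (simp add: gnn_apply_def)
  have verts: "verts (gnn_apply Col N (enc \<delta> E)) = dataset_consts E" for E :: "('c, 'x) fact set"
    by (simp add: gnn_apply_def enc_def)
  have a: "p < \<delta>" "a \<in> dataset_consts D" "threshold N \<le> feat Col N (enc \<delta> D) ?L a $ p"
    using U index[of D a] by (auto simp: gnn_op_def dec_def verts cls_def split: if_splits)
  have U_hom: "U i (f v) \<in> D'" if "U i v \<in> D" for i v
    using imageI[OF that, of "map_atom id f"] hom by auto
  have R_hom: "R c (f v) (f u) \<in> D'" if "R c v u \<in> D" for c v u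
    using imageI[OF that, of "map_atom id f"] hom by auto
  have R_consts: "u \<in> dataset_consts D" if "R c v u \<in> D" for c v u
    using that by (force simp: dataset_consts_def)
  \<comment> \<open>Here \<open>V\<close> is \<open>dataset_consts D\<close>, the vertex set of the
    encoding; \<open>R_consts\<close> shows that edges end in it.\<close>
  have "(stable_channel Col N ?L p \<longrightarrow> feat Col N (enc \<delta> D) ?L a $ p = feat Col N (enc \<delta> D') ?L (f a) $ p) \<and>
    (increasing_channel Col N ?L p \<longrightarrow> feat Col N (enc \<delta> D) ?L a $ p \<le> feat Col N (enc \<delta> D') ?L (f a) $ p) \<and>
    (decreasing_channel Col N ?L p \<longrightarrow> feat Col N (enc \<delta> D) ?L a $ p \<ge> feat Col N (enc \<delta> D') ?L (f a) $ p)"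
    using a(1,2) U_hom R_hom R_consts dim
    by (intro feat_mono[OF Col N lab lab _ _ finite_enc_nbrs[OF D] finite_enc_nbrs[OF D'] f])
      (auto simp: enc_def)
  with p a(3) have "threshold N \<le> feat Col N (enc \<delta> D') ?L (f a) $ p" by auto
  \<comment> \<open>\<open>dec\<close> yields unary facts only for vertices of the encoding, so
    \<open>f a\<close> has to occur in \<open>D'\<close>.\<close>
  moreover have "f a \<in> dataset_consts D'"
    using a(2) hom dataset_consts_map_atom[of f D] by (fastforce simp: dataset_consts_def)
  ultimately show ?thesis
    using a(1) index[of D' "f a"] by (auto simp: gnn_op_def dec_def verts cls_def)
qed


section \<open>Rules and the finite test\<close>

lemma finite_body_atoms: "finite (body_atoms r)"
proof -
  have "body_atoms r = Atom -` set (body r)" by (auto simp: body_atoms_def)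
  then show ?thesis by (simp add: finite_vimageI inj_def)
qed

lemma finite_rule_terms: "finite (rule_terms r)"
proof -
  have atom: "finite (atom_terms A)" for A :: "('c, 't) atom" by (cases A) auto
  then have "finite (lit_terms l)" for l :: "('c, 't) literal" by (cases l) auto
  with atom show ?thesis by (simp add: rule_terms_def)
qed

lemma finite_rule_vars: "finite (rule_vars r)"
proof -
  have "finite (trm_vars t)" for t :: "('v, 'k) trm" by (cases t) auto
  then show ?thesis by (simp add: rule_vars_def finite_rule_terms)
qed

lemma finite_rule_consts: "finite (rule_consts r)"
proof -
  have "finite (trm_consts t)" for t :: "('v, 'k) trm" by (cases t) auto
  then show ?thesis by (simp add: rule_consts_def finite_rule_terms)
qed

lemma atom_over_map [simp]: "atom_over Col \<delta> (map_atom id f A) = atom_over Col \<delta> A"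
  by (cases A) auto

lemma dataset_body_dataset:
  assumes "rule_over Col \<delta> r"
  shows "dataset Col \<delta> (body_dataset r \<nu>)"
  using assms finite_body_atoms[of r]
  by (auto simp: dataset_def body_dataset_def rule_over_def subst_atom_def)

text \<open>A tested \<open>\<nu>\<close> matches the body of \<open>r\<close> in its own body
  dataset: atoms by construction, inequalities by the condition in the test. Each test is thus an
  instance of soundness.\<close>

lemma sound_imp_passes_test:
  fixes r :: "('c, 'v, 'k) rule"
  assumes "rule_over Col \<delta> r" and "sound Col \<delta> N r"
  shows "passes_test Col \<delta> N r T"
  unfolding passes_test_def
proof (intro allI impI, elim conjE)
  fix \<nu> :: "('v, 'k) subst"
  assume dom: "dom \<nu> = rule_vars r"
    and neq: "\<forall>s t. Neq s t \<in> set (body r) \<longrightarrow> models (body_dataset r \<nu>) (subst_lit \<nu> (Neq s t))"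
  have "models (body_dataset r \<nu>) (subst_lit \<nu> l)" if "l \<in> set (body r)" for l
    by (cases l) (use that neq in \<open>auto simp: body_dataset_def body_atoms_def subst_lit_def subst_atom_def\<close>)
  then have "subst_atom \<nu> (head r) \<in> rule_op r (body_dataset r \<nu>)"
    using dom finite_rule_vars[of r] by (auto simp: rule_op_def intro!: exI[of _ \<nu>])
  then show "subst_atom \<nu> (head r) \<in> gnn_op Col \<delta> N (body_dataset r \<nu>)"
    using assms dataset_body_dataset by (fastforce simp: sound_def)
qed

text \<open>The identity on \<open>C\<close> is glued to an injection of \<open>V - C\<close> into
  \<open>T - C\<close>; disjoint ranges keep the result injective. \<open>C\<close> will hold the
  constants of the rule, which no substitution can rename.\<close>

lemma ex_injective_renaming:
  assumes "finite V" and "finite T" and "C \<subseteq> T" and "card (V - C) \<le> card (T - C)"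
  obtains g where "inj_on g (V \<union> C)" and "g ` (V \<union> C) \<subseteq> T" and "\<And>a. a \<in> C \<Longrightarrow> g a = a"
proof -
  obtain k where k: "inj_on k (V - C)" "k ` (V - C) \<subseteq> T - C"
    using assms card_le_inj[of "V - C" "T - C"] by auto
  define g where "g a = (if a \<in> C then a else k a)" for a
  have k': "k a \<in> T - C" if "a \<in> V" "a \<notin> C" for a
    using k(2) that by auto
  have "inj_on g (V \<union> C)"
    using k(1) k' by (auto simp: inj_on_def g_def)
  moreover have "g ` (V \<union> C) \<subseteq> T"
    using k' assms(3) by (auto simp: g_def)
  ultimately show thesis using that[of g] by (simp add: g_def)
qed

lemma passes_test_imp_sound:
  fixes r :: "('c, 'v, 'k) rule"
  assumes Col: "finite Col" and N: "sum_gnn Col \<delta> N" and r: "rule_over Col \<delta> r"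
    and head: "head r = U p h"
    and p: "increasing_channel Col N (layers N) p \<or> stable_channel Col N (layers N) p"
    and T: "finite T" "rule_consts r \<subseteq> T" "card (rule_vars r) \<le> card (T - rule_consts r)"
    and test: "passes_test Col \<delta> N r T"
  shows "sound Col \<delta> N r"
  unfolding sound_def
proof (intro allI impI subsetI)
  fix D B assume D: "dataset Col \<delta> D" and "B \<in> rule_op r D"
  then obtain \<nu> where B: "B = subst_atom \<nu> (head r)" and dom: "rule_vars r \<subseteq> dom \<nu>"
    and match: "\<And>l. l \<in> set (body r) \<Longrightarrow> models D (subst_lit \<nu> l)"
    by (auto simp: rule_op_def)
  define V where "V = (\<lambda>x. the (\<nu> x)) ` rule_vars r"
  have "finite V" and "card V \<le> card (rule_vars r)"
    by (simp_all add: V_def finite_rule_vars card_image_le)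
  then have "card (V - rule_consts r) \<le> card (T - rule_consts r)"
    using T(3) card_mono[of V "V - rule_consts r"] by simp
  with \<open>finite V\<close> T(1,2) obtain g where g: "inj_on g (V \<union> rule_consts r)"
      and g_ran: "g ` (V \<union> rule_consts r) \<subseteq> T" and g_id: "\<And>a. a \<in> rule_consts r \<Longrightarrow> g a = a"
    using ex_injective_renaming by metis
  define f where "f = inv_into (V \<union> rule_consts r) g"
  \<comment> \<open>The test wants the domain to be exactly the variables of the rule, whereas
    \<open>\<nu>\<close> may be defined on more.\<close>
  define \<mu> where "\<mu> x = (if x \<in> rule_vars r then Some (g (the (\<nu> x))) else None)" for x
  have t_in: "subst_trm \<nu> t \<in> V \<union> rule_consts r" if "t \<in> rule_terms r" for t
    using that by (cases t) (force simp: V_def rule_vars_def rule_consts_def)+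
  have \<mu>: "subst_trm \<mu> t = g (subst_trm \<nu> t)" if "t \<in> rule_terms r" for t
  proof (cases t)
    case (Var x)
    then have "x \<in> rule_vars r" using that by (force simp: rule_vars_def)
    then show ?thesis using Var by (simp add: \<mu>_def)
  next
    case (Const a)
    then have "a \<in> rule_consts r" using that by (force simp: rule_consts_def)
    then show ?thesis using Const g_id by simp
  qed
  have f: "f (subst_trm \<mu> t) = subst_trm \<nu> t" if "t \<in> rule_terms r" for t
    using \<mu>[OF that] t_in[OF that] g by (simp add: f_def)
  have body_terms: "atom_terms A \<subseteq> rule_terms r" if "A \<in> body_atoms r" for A
    using that by (force simp: body_atoms_def rule_terms_def)
  have "dom \<mu> = rule_vars r" by (auto simp: \<mu>_def dom_def)
  moreover have "ran \<mu> \<subseteq> T"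
    using g_ran by (auto simp: \<mu>_def ran_def V_def split: if_splits)
  \<comment> \<open>If \<open>\<mu>\<close> identified \<open>s\<close> and \<open>t\<close>,
    applying \<open>f\<close> would identify their values under \<open>\<nu>\<close>.\<close>
  moreover have "models (body_dataset r \<mu>) (subst_lit \<mu> (Neq s t))" if st: "Neq s t \<in> set (body r)" for s t
  proof -
    have terms: "s \<in> rule_terms r" "t \<in> rule_terms r"
      using st by (force simp: rule_terms_def)+
    have "subst_trm \<nu> s \<noteq> subst_trm \<nu> t"
      using match[OF st] by (simp add: subst_lit_def)
    then show ?thesis using f terms by (auto simp: subst_lit_def) metis
  qed
  ultimately have "U p (subst_trm \<mu> h) \<in> gnn_op Col \<delta> N (body_dataset r \<mu>)"
    using test head by (auto simp: passes_test_def subst_atom_def)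
  moreover have "inj_on f (dataset_consts (body_dataset r \<mu>))"
  proof (rule inj_on_subset)
    show "inj_on f (g ` (V \<union> rule_consts r))"
      unfolding f_def by (rule inj_on_inv_into) simp
    show "dataset_consts (body_dataset r \<mu>) \<subseteq> g ` (V \<union> rule_consts r)"
      using body_terms \<mu> t_in
      by (fastforce simp: dataset_consts_def body_dataset_def subst_atom_def atom.set_map)
  qed
  \<comment> \<open>On terms of the rule \<open>f\<close> undoes the renaming, so each body atom
    under \<open>\<mu>\<close> goes to the same atom under \<open>\<nu>\<close>, which the match
    places in \<open>D\<close>.\<close>
  moreover have "map_atom id f ` body_dataset r \<mu> \<subseteq> D"
  proof clarify
    fix A' assume "A' \<in> body_dataset r \<mu>"
    then obtain A where A: "A \<in> body_atoms r" "A' = subst_atom \<mu> A"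
      by (auto simp: body_dataset_def)
    then have "map_atom id f A' = map_atom id (subst_trm \<nu>) A"
      using body_terms[OF A(1)] f by (auto simp: subst_atom_def atom.map_comp intro!: atom.map_cong0)
    then show "map_atom id f A' \<in> D"
      using match[of "Atom A"] A(1) by (simp add: subst_lit_def body_atoms_def)
  qed
  moreover have "finite (body_dataset r \<mu>)" "finite D"
    using D dataset_body_dataset[OF r] by (auto simp: dataset_def)
  ultimately have "U p (f (subst_trm \<mu> h)) \<in> gnn_op Col \<delta> N D"
    using gnn_op_hom[OF Col N] p by metis
  moreover have "h \<in> rule_terms r" by (simp add: rule_terms_def head)
  ultimately show "B \<in> gnn_op Col \<delta> N D"
    using f by (simp add: B head subst_atom_def)
qed

text \<open>A match may send a variable to a constant of the rule, a case that substitutions into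
  \<open>S\<close> alone can miss. Hence the equivalence for \<open>S\<close> itself is claimed for
  constant-free rules, and otherwise the rule's constants join the test set.\<close>

theorem proposition7:
  fixes Col :: "'c set" and \<delta> p :: nat and N :: "'c gnn"
    and r :: "('c, 'v :: {countable, infinite}, 'k :: {countable, infinite}) rule"
    and h :: "('v, 'k) trm" and S :: "'k set"
  assumes "finite Col" and "\<delta> \<ge> 1"
    and "sum_gnn Col \<delta> N"
    and "rule_over Col \<delta> r"
    and "head r = U p h" and "p < \<delta>"
    and "finite S" and "card S = card (rule_vars r)"
    and "increasing_channel Col N (layers N) p \<or> stable_channel Col N (layers N) p"
  shows "(sound Col \<delta> N r \<longrightarrow> passes_test Col \<delta> N r S) \<and>
         (rule_consts r = {} \<longrightarrow> (sound Col \<delta> N r \<longleftrightarrow> passes_test Col \<delta> N r S)) \<and>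
         (S \<inter> rule_consts r = {} \<longrightarrow>
            (sound Col \<delta> N r \<longleftrightarrow> passes_test Col \<delta> N r (S \<union> rule_consts r)))"
proof -
  have "sound Col \<delta> N r" if "S \<inter> rule_consts r = {}" "passes_test Col \<delta> N r (S \<union> rule_consts r)"
  proof (rule passes_test_imp_sound[OF assms(1,3,4,5,9) _ _ _ that(2)])
    \<comment> \<open>Disjointness leaves exactly one fresh constant per variable for the
      renaming.\<close>
    have "S \<union> rule_consts r - rule_consts r = S" using that(1) by auto
    then show "card (rule_vars r) \<le> card (S \<union> rule_consts r - rule_consts r)"
      using assms(8) by simp
  qed (use assms(7) finite_rule_consts in auto)
  \<comment> \<open>If \<open>rule_consts r\<close> is empty, the enlarged test set collapses to
    \<open>S\<close>, so the second claim is an instance of the third.\<close>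
  then show ?thesis
    using sound_imp_passes_test[OF assms(4)] by (metis Int_empty_right Un_empty_right)
qed

end
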